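(* Let $P$ be an order-consistent normal logic program and let $a$ be an atom that belongs to every answer set for $P$. Then every answer set for the program $P \cup \{a \leftarrow\}$ is an answer set for $P$.
   Context: Fix a set of symbols called atoms. A rule $r$ consists of an atom $\mathit{head}(r)$ and two finite sets of atoms, $\mathit{pos}(r)$ (positive subgoals) and $\mathit{neg}(r)$ (negated subgoals); it is written $a \leftarrow b_1,\dots,b_m, \mathit{not}\; c_1,\dots,\mathit{not}\; c_n$. A program is a (possibly infinite) set of rules. The rule $a\leftarrow$ has head $a$ and no subgoals. A program is positive if $\mathit{neg}(r)=\emptyset$ for all its rules. A set $X$ of atoms is closed under a positive program $P$ if for every $r\in P$ with $\mathit{pos}(r)\subseteq X$ we have $\mathit{head}(r)\in X$; the answer set of a positive program is the least set of atoms closed under it. For an arbitrary program $P$ and set of atoms $X$, the reduct $P^X$ is the positive program consisting of the rules $\mathit{head}(r)\leftarrow \mathit{pos}(r)$ for all $r\in P$ with $\mathit{neg}(r)\cap X=\emptyset$; $X$ is an answer set for $P$ if $X$ is the answer set for $P^X$. For a program $P$ and atom $a$, $P^+_a$ and $P^-_a$ are the smallest sets of atoms such that $a\in P^+_a$ and for every rule $r\in P$: if $\mathit{head}(r)\in P^+_a$ then $\mathit{pos}(r)\subseteq P^+_a$ and $\mathit{neg}(r)\subseteq P^-_a$; if $\mathit{head}(r)\in P^-_a$ then $\mathit{pos}(r)\subseteq P^-_a$ and $\mathit{neg}(r)\subseteq P^+_a$. A level mapping is a function from atoms to ordinals. A program $P$ is order-consistent if there is a level mapping $\lambda$ such that $\lambda(b)<\lambda(a)$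 whenever $b\in P^+_a\cap P^-_a$. *)

theory Defs
  imports "HOL-Library.FSet"
begin

unbundle cardinal_syntax

text \<open>Atoms are the elements of an arbitrary type \<open>'a\<close>.\<close>

datatype 'a rule = Rule (head: 'a) (pos: "'a fset") (neg: "'a fset")

type_synonym 'a program = "'a rule set"

definition fact_rule :: "'a \<Rightarrow> 'a rule" where
  "fact_rule a = Rule a {||} {||}"

definition positive :: "'a program \<Rightarrow> bool" where
  "positive P \<longleftrightarrow> (\<forall>r\<in>P. neg r = {||})"

definition closed_under :: "'a program \<Rightarrow> 'a set \<Rightarrow> bool" where
  "closed_under P X \<longleftrightarrow> (\<forall>r\<in>P. fset (pos r) \<subseteq> X \<longrightarrow> head r \<in> X)"

text \<open>Meant for positive programs only; negated subgoals are ignored.\<close>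

definition positive_answer_set :: "'a program \<Rightarrow> 'a set \<Rightarrow> bool" where
  "positive_answer_set P X \<longleftrightarrow>
     closed_under P X \<and> (\<forall>Y. closed_under P Y \<longrightarrow> X \<subseteq> Y)"

definition reduct :: "'a program \<Rightarrow> 'a set \<Rightarrow> 'a program" where
  "reduct P X = {Rule (head r) (pos r) {||} | r. r \<in> P \<and> fset (neg r) \<inter> X = {}}"

lemma positive_reduct: "positive (reduct P X)"
  by (auto simp: positive_def reduct_def)

definition answer_set :: "'a program \<Rightarrow> 'a set \<Rightarrow> bool" where
  "answer_set P X \<longleftrightarrow> positive_answer_set (reduct P X) X"

lemma answer_set_positive:
  assumes "positive P"
  shows "answer_set P X \<longleftrightarrow> positive_answer_set P X"
proof -
  have "r = Rule (head r) (pos r) {||}" if "r \<in> P" for r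
    using assms that by (cases r) (auto simp: positive_def)
  then have "reduct P X = P"
    using assms by (fastforce simp: reduct_def positive_def)
  then show ?thesis by (simp add: answer_set_def)
qed

text \<open>\<open>pos_dep P a\<close> and \<open>neg_dep P a\<close> are the sets $P^+_a$ and $P^-_a$.\<close>

inductive_set pos_dep :: "'a program \<Rightarrow> 'a \<Rightarrow> 'a set"
  and neg_dep :: "'a program \<Rightarrow> 'a \<Rightarrow> 'a set"
  for P :: "'a program" and a :: 'a
where
  self: "a \<in> pos_dep P a"
| pos_pos: "r \<in> P \<Longrightarrow> head r \<in> pos_dep P a \<Longrightarrow> b \<in> fset (pos r) \<Longrightarrow> b \<in> pos_dep P a"
| pos_neg: "r \<in> P \<Longrightarrow> head r \<in> pos_dep P a \<Longrightarrow> c \<in> fset (neg r) \<Longrightarrow> c \<in> neg_dep P a"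
| neg_pos: "r \<in> P \<Longrightarrow> head r \<in> neg_dep P a \<Longrightarrow> b \<in> fset (pos r) \<Longrightarrow> b \<in> neg_dep P a"
| neg_neg: "r \<in> P \<Longrightarrow> head r \<in> neg_dep P a \<Longrightarrow> c \<in> fset (neg r) \<Longrightarrow> c \<in> pos_dep P a"

text \<open>
  Ordinals are represented by well-orders, compared by the strict ordinal order \<open><o\<close>.
  Well-orders on subsets of the type of atoms suffice: by \<open>order_consistentI\<close> below,
  the choice of the carrier type in the definition of \<open>order_consistent\<close> is no restriction.
\<close>

definition level_mapping :: "('a \<Rightarrow> 'o rel) \<Rightarrow> bool" where
  "level_mapping l \<longleftrightarrow> (\<forall>a. Well_order (l a))"

definition order_consistent :: "'a program \<Rightarrow> bool" where
  "order_consistent P \<longleftrightarrow>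
     (\<exists>l :: 'a \<Rightarrow> 'a rel. level_mapping l \<and>
        (\<forall>a b. b \<in> pos_dep P a \<inter> neg_dep P a \<longrightarrow> l b <o l a))"

lemma level_mapping_transfer:
  fixes l :: "'a \<Rightarrow> 'o rel"
  assumes "level_mapping l"
  shows "\<exists>l' :: 'a \<Rightarrow> 'a rel. level_mapping l' \<and> (\<forall>a b. l b <o l a \<longrightarrow> l' b <o l' a)"
proof -
  have wo: "Well_order (l a)" for a
    using assms by (simp add: level_mapping_def)
  obtain r :: "'a rel" where r: "well_order_on UNIV r"
    using well_order_on by blast
  have rlin: "refl r" "trans r" "antisym r" "total r" "wf (r - Id)"
    using r by (auto simp: well_order_on_def linear_order_on_def partial_order_on_def
        preorder_on_def)
  define w :: "'a rel" where
    "w = {(x, y). l x <o l y \<or> \<not> l y <o l x \<and> (x, y) \<in> r}"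
  have ole: "\<not> l x <o l y \<longleftrightarrow> l y \<le>o l x" for x y
    using wo not_ordLess_iff_ordLeq by blast
  have "refl w"
    using rlin(1) ordLess_irreflexive by (auto simp: w_def refl_on_def)
  moreover have tr: "trans w"
  proof (rule transI)
    fix x y z assume xy: "(x, y) \<in> w" and yz: "(y, z) \<in> w"
    then have le: "l x \<le>o l y" "l y \<le>o l z"
      by (auto simp: w_def ole ordLess_imp_ordLeq)
    show "(x, z) \<in> w"
    proof (cases "l x <o l z")
      case False
      then have "\<not> l x <o l y" "\<not> l y <o l z"
        using le ordLess_ordLeq_trans ordLeq_ordLess_trans by blast+
      then have "(x, z) \<in> r"
        using xy yz rlin(2) by (auto simp: w_def dest: transD)
      moreover have "\<not> l z <o l x"
        using le ordLeq_transitive ole by blast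
      ultimately show ?thesis by (simp add: w_def)
    qed (simp add: w_def)
  qed
  moreover have an: "antisym w"
    unfolding w_def antisym_def
    using rlin(3) ordLess_transitive ordLess_irreflexive
    by (blast dest: antisymD)
  moreover have "total w"
    using rlin(1,4) unfolding total_on_def refl_on_def w_def by blast
  moreover have "wf (w - Id)"
  proof -
    have wfo: "wf (inv_image (ordLess :: 'o rel rel) l)"
      using wf_ordLess by (rule wf_inv_image)
    show ?thesis
    proof (rule wfI_min)
      fix x :: 'a and Q :: "'a set" assume "x \<in> Q"
      then obtain m where m: "m \<in> Q" "\<And>y. l y <o l m \<Longrightarrow> y \<notin> Q"
        using wfE_min[OF wfo] by (metis in_inv_image)
      then have "m \<in> {y \<in> Q. \<not> l m <o l y}"
        using ordLess_irreflexive by blast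
      then obtain z where zm: "z \<in> {y \<in> Q. \<not> l m <o l y}"
        "\<forall>y. (y, z) \<in> r - Id \<longrightarrow> y \<notin> {y \<in> Q. \<not> l m <o l y}"
        using rlin(5) unfolding wf_eq_minimal by meson
      then have z: "z \<in> Q" "\<not> l m <o l z"
        by auto
      have "y \<notin> Q" if "(y, z) \<in> w - Id" for y
      proof
        assume "y \<in> Q"
        then have my: "\<not> l y <o l m" using m(2) by blast
        from that consider "l y <o l z" | "\<not> l z <o l y" "(y, z) \<in> r - Id"
          by (auto simp: w_def)
        then show False
        proof cases
          case 1
          then show ?thesis using my z(2) ole ordLess_ordLeq_trans by blast
        next
          case 2
          then have "l m <o l y" using zm(2) \<open>y \<in> Q\<close> by simp
          then show ?thesis using 2(1) z(2) ole ordLess_ordLeq_trans by blast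
        qed
      qed
      with z(1) show "\<exists>z\<in>Q. \<forall>y. (y, z) \<in> w - Id \<longrightarrow> y \<notin> Q" by blast
    qed
  qed
  ultimately have w: "well_order_on UNIV w"
    by (auto simp: well_order_on_def linear_order_on_def partial_order_on_def preorder_on_def)
  have F: "Field w = UNIV" using w well_order_on_Field by blast
  have W: "Well_order w" using w F by simp
  define l' where "l' a = Restr w (underS w a)" for a
  have lm: "level_mapping l'"
    using W by (auto simp: level_mapping_def l'_def intro: Well_order_Restr)
  have "l' b <o l' a" if "l b <o l a" for a b
  proof -
    have "(b, a) \<in> w" "b \<noteq> a" 
      using that ordLess_irreflexive by (auto simp: w_def)
    then have "underS w b \<subset> underS w a"
      using tr an
      by (auto simp: underS_def psubset_eq set_eq_iff dest: transD antisymD)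
    moreover have "wo_rel w" using W by (simp add: wo_rel_def)
    then have "wo_rel.ofilter w (underS w c)" for c
      by (rule wo_rel.underS_ofilter)
    ultimately show ?thesis
      unfolding l'_def by (simp only: ofilter_subset_ordLess[OF W])
  qed
  with lm show ?thesis by blast
qed

lemma order_consistentI:
  fixes l :: "'a \<Rightarrow> 'o rel"
  assumes "level_mapping l"
    and "\<And>a b. b \<in> pos_dep P a \<inter> neg_dep P a \<Longrightarrow> l b <o l a"
  shows "order_consistent P"
  using level_mapping_transfer[OF assms(1)] assms(2) unfolding order_consistent_def by blast

end

theory Submission
  imports Defs
begin

text \<open>
  Let \<open>\<Gamma> X\<close> be the least model of the reduct by \<open>X\<close>; it is antitone in \<open>X\<close>. If a set \<open>W\<close> of
  atoms depends positively only on itself and negatively only on a set \<open>Q\<close>, and vice versa, then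
  the values of \<open>\<Gamma>\<close> on \<open>W\<close> depend only on the argument on \<open>Q\<close> and vice versa. So once the
  answer set is fixed on the part \<open>W \<inter> Q\<close>, the answer sets on \<open>W \<union> Q\<close> are fixed points of a
  monotone operator, and the least fixed point yields one that is minimal on \<open>W\<close>.
  With \<open>W\<close> and \<open>Q\<close> obtained from $P^+_a$ and $P^-_a$ for an atom \<open>a\<close> of minimal level, and with
  Zorn's lemma, this extends every answer set on a part closed under dependencies to a full one.

  Now let \<open>X\<close> be an answer set for \<open>P\<close> plus the fact \<open>a\<close>. If \<open>a \<in> \<Gamma> X\<close>, then \<open>X\<close> is an answer
  set for \<open>P\<close>. Otherwise \<open>\<Gamma> X\<close> restricted to $P^+_a$ is a prefixed point of the operator above, so
  the minimal answer set on $P^+_a \cup P^-_a$ omits \<open>a\<close>, and so does its extension to all atoms.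
\<close>

section \<open>Least models of reducts\<close>

inductive_set reduct_model :: "'a program \<Rightarrow> 'a set \<Rightarrow> 'a set"
  for P :: "'a program" and X :: "'a set" where
  step: "r \<in> P \<Longrightarrow> fset (neg r) \<inter> X = {} \<Longrightarrow> (\<And>b. b \<in> fset (pos r) \<Longrightarrow> b \<in> reduct_model P X)
    \<Longrightarrow> head r \<in> reduct_model P X"

lemma answer_set_iff_reduct_model: "answer_set P X \<longleftrightarrow> reduct_model P X = X"
proof -
  have closed: "closed_under (reduct P X) Y \<longleftrightarrow>
      (\<forall>r\<in>P. fset (neg r) \<inter> X = {} \<longrightarrow> fset (pos r) \<subseteq> Y \<longrightarrow> head r \<in> Y)" for Y
  proof -
    have "reduct P X = (\<lambda>r. Rule (head r) (pos r) {||}) ` {r \<in> P. fset (neg r) \<inter> X = {}}"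
      by (auto simp: reduct_def)
    then show ?thesis by (simp add: closed_under_def) blast
  qed
  have "closed_under (reduct P X) (reduct_model P X)"
    unfolding closed by (blast intro: reduct_model.step)
  moreover have "reduct_model P X \<subseteq> Y" if "closed_under (reduct P X) Y" for Y
  proof
    fix x assume "x \<in> reduct_model P X"
    then show "x \<in> Y" using that unfolding closed by induction blast
  qed
  ultimately show ?thesis
    unfolding answer_set_def positive_answer_set_def by (metis subset_antisym)
qed

lemma reduct_model_mono:
  assumes "P \<subseteq> P'"
  shows "reduct_model P X \<subseteq> reduct_model P' X"
proof
  fix x assume "x \<in> reduct_model P X"
  then show "x \<in> reduct_model P' X"
    using assms by induction (blast intro: reduct_model.step)
qed

section \<open>Signed dependencies and locality\<close>

definition depends_within :: "'a program \<Rightarrow> 'a set \<Rightarrow> 'a set \<Rightarrow> bool" where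
  "depends_within P W Q \<longleftrightarrow>
     (\<forall>r\<in>P. head r \<in> W \<longrightarrow> fset (pos r) \<subseteq> W \<and> fset (neg r) \<subseteq> Q)"

lemma depends_within_Un:
  "depends_within P W Q \<Longrightarrow> depends_within P W' Q' \<Longrightarrow> depends_within P (W \<union> W') (Q \<union> Q')"
  by (auto simp: depends_within_def)

lemma depends_within_Int:
  "depends_within P W Q \<Longrightarrow> depends_within P W' Q' \<Longrightarrow> depends_within P (W \<inter> W') (Q \<inter> Q')"
  by (auto simp: depends_within_def)

lemma depends_within_Union:
  "(\<And>U. U \<in> \<U> \<Longrightarrow> depends_within P U U) \<Longrightarrow> depends_within P (\<Union>\<U>) (\<Union>\<U>)"
  unfolding depends_within_def by blast

lemma depends_within_dep:
  "depends_within P (pos_dep P a) (neg_dep P a)"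
  "depends_within P (neg_dep P a) (pos_dep P a)"
  by (auto simp: depends_within_def intro: pos_dep_neg_dep.intros)

text \<open>A derivation of an atom of \<open>W\<close> uses only atoms of \<open>W\<close>, through
  rules whose negated subgoals lie in \<open>Q\<close>. Such a rule survives in the reduct by
  \<open>X\<close> if it survives in the one by \<open>Y\<close>.\<close>

lemma reduct_model_antimono_on:
  assumes "depends_within P W Q" and "X \<inter> Q \<subseteq> Y"
  shows "reduct_model P Y \<inter> W \<subseteq> reduct_model P X"
proof -
  have "x \<in> W \<longrightarrow> x \<in> reduct_model P X" if "x \<in> reduct_model P Y" for x
    using that
  proof induction
    case (step r)
    show ?case
    proof
      assume "head r \<in> W"
      with assms(1) step.hyps(1) have "fset (pos r) \<subseteq> W" "fset (neg r) \<subseteq> Q"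
        by (auto simp: depends_within_def)
      with assms(2) step show "head r \<in> reduct_model P X"
        by (intro reduct_model.step) blast+
    qed
  qed
  then show ?thesis by blast
qed

lemma reduct_model_antimono: "X \<subseteq> Y \<Longrightarrow> reduct_model P Y \<subseteq> reduct_model P X"
  using reduct_model_antimono_on[of P UNIV UNIV X Y] by (simp add: depends_within_def)

lemma reduct_model_cong_on:
  assumes "depends_within P W Q" and "X \<inter> Q = Y \<inter> Q"
  shows "reduct_model P X \<inter> W = reduct_model P Y \<inter> W"
  using reduct_model_antimono_on[OF assms(1)] assms(2) by blast

section \<open>Partial answer sets and their extensions\<close>

text \<open>Amounts to an answer set for the rules of \<open>P\<close> with head in
  \<open>U\<close>; the equation also forces \<open>Z \<subseteq> U\<close>.\<close>

definition partial_answer_set :: "'a program \<Rightarrow> 'a set \<Rightarrow> 'a set \<Rightarrow> bool" where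
  "partial_answer_set P U Z \<longleftrightarrow> depends_within P U U \<and> reduct_model P Z \<inter> U = Z"

lemma minimal_extension:
  assumes W: "depends_within P W Q" and Q: "depends_within P Q W"
    and Z: "partial_answer_set P (W \<inter> Q) Z"
  obtains Z' where "partial_answer_set P (W \<union> Q) Z'" "Z' \<inter> (W \<inter> Q) = Z"
    "\<And>Y. Z \<subseteq> Y \<Longrightarrow> reduct_model P (reduct_model P Y \<inter> Q) \<inter> W \<subseteq> Y \<Longrightarrow> Z' \<inter> W \<subseteq> Y"
proof -
  let ?\<Gamma> = "reduct_model P"
  define U where "U = W \<inter> Q"
  have U: "depends_within P U U" and ZU: "?\<Gamma> Z \<inter> U = Z"
    using Z by (auto simp: partial_answer_set_def U_def)
  define F where "F S = ?\<Gamma> (?\<Gamma> S \<inter> Q) \<inter> W" for S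
  \<comment> \<open>Freezing the values on \<open>U\<close> to \<open>Z\<close> keeps the least
    fixed point from making a different choice there.\<close>
  define G where "G S = Z \<union> (F S - U)" for S
  have "mono G"
  proof
    fix S T :: "'a set" assume "S \<subseteq> T"
    then have "?\<Gamma> T \<inter> Q \<subseteq> ?\<Gamma> S \<inter> Q" using reduct_model_antimono by blast
    then have "F S \<subseteq> F T" using reduct_model_antimono unfolding F_def by blast
    then show "G S \<subseteq> G T" by (auto simp: G_def)
  qed
  define S where "S = lfp G"
  have SG: "S = G S" unfolding S_def using \<open>mono G\<close> by (rule lfp_unfold)
  have SU: "S \<inter> U = Z" using SG ZU by (auto simp: G_def)
  have \<Gamma>S: "?\<Gamma> S \<inter> U = Z"
    using reduct_model_cong_on[OF U, of S Z] SU ZU by blast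
  have "?\<Gamma> (?\<Gamma> S \<inter> Q) \<inter> U = Z"
    using reduct_model_cong_on[OF U, of "?\<Gamma> S \<inter> Q" Z] \<Gamma>S ZU by (auto simp: U_def)
  then have SF: "S = F S" using SG by (auto simp: G_def F_def U_def)
  define B where "B = ?\<Gamma> S \<inter> Q"
  have SB: "S = ?\<Gamma> B \<inter> W" using SF by (simp add: F_def B_def)
  \<comment> \<open>\<open>S\<close> and \<open>B\<close> both restrict to \<open>Z\<close> on the
    overlap. So \<open>S \<union> B\<close> looks like \<open>B\<close> from \<open>Q\<close> and
    like \<open>S\<close> from \<open>W\<close>, and locality turns the two-step fixed point into a
    one-step one.\<close>
  have SQ: "(S \<union> B) \<inter> Q = B \<inter> Q" and BW: "(S \<union> B) \<inter> W = S \<inter> W"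
    using SU \<Gamma>S SB unfolding B_def U_def by blast+
  have "?\<Gamma> (S \<union> B) \<inter> W = S" "?\<Gamma> (S \<union> B) \<inter> Q = B"
    using reduct_model_cong_on[OF W SQ] reduct_model_cong_on[OF Q BW]
    by (simp_all only: SB[symmetric] B_def[symmetric])
  then have "?\<Gamma> (S \<union> B) \<inter> (W \<union> Q) = S \<union> B" by blast
  moreover have "depends_within P (W \<union> Q) (W \<union> Q)"
    using depends_within_Un[OF W Q] by (simp add: Un_commute)
  ultimately have "partial_answer_set P (W \<union> Q) (S \<union> B)"
    by (simp add: partial_answer_set_def)
  moreover have "(S \<union> B) \<inter> (W \<inter> Q) = Z" using SU BW by (auto simp: U_def)
  moreover have "(S \<union> B) \<inter> W \<subseteq> Y" if "Z \<subseteq> Y" "?\<Gamma> (?\<Gamma> Y \<inter> Q) \<inter> W \<subseteq> Y" for Y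
  proof -
    have "G Y \<subseteq> Y" using that by (auto simp: G_def F_def)
    then have "S \<subseteq> Y" unfolding S_def by (rule lfp_lowerbound)
    then show ?thesis using BW by blast
  qed
  ultimately show thesis by (rule that)
qed

lemma order_consistent_extension:
  assumes P: "order_consistent P" and Z: "partial_answer_set P U Z" and "U \<noteq> UNIV"
  obtains U' Z' where "partial_answer_set P U' Z'" "U \<subset> U'" "Z' \<inter> U = Z"
proof -
  obtain l :: "'a \<Rightarrow> 'a rel"
    where l: "\<And>a b. b \<in> pos_dep P a \<inter> neg_dep P a \<Longrightarrow> l b <o l a"
    using P by (auto simp: order_consistent_def)
  have "wf (inv_image (ordLess :: 'a rel rel) l)"
    using wf_ordLess by (rule wf_inv_image)
  moreover obtain a0 where "a0 \<in> - U" using \<open>U \<noteq> UNIV\<close> by blast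
  ultimately obtain a where a: "a \<notin> U" "\<And>b. l b <o l a \<Longrightarrow> b \<in> U"
    by (metis ComplD ComplI in_inv_image wfE_min)
  define W where "W = U \<union> pos_dep P a"
  define Q where "Q = U \<union> neg_dep P a"
  have U: "depends_within P U U" using Z by (simp add: partial_answer_set_def)
  have dep: "depends_within P W Q" "depends_within P Q W"
    unfolding W_def Q_def by (intro depends_within_Un U depends_within_dep)+
  \<comment> \<open>Atoms in both dependency sets have a level below that of \<open>a\<close>, so
    they lie in \<open>U\<close> by minimality: the overlap is exactly the part already
    decided.\<close>
  have WQ: "W \<inter> Q = U" using l a(2) by (auto simp: W_def Q_def)
  obtain Z' where "partial_answer_set P (W \<union> Q) Z'" "Z' \<inter> U = Z"
    using minimal_extension[OF dep, of Z] Z WQ by metis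
  moreover have "a \<in> W" by (simp add: W_def pos_dep_neg_dep.self)
  then have "U \<subset> W \<union> Q" using a(1) by (auto simp: W_def)
  ultimately show thesis using that by blast
qed

text \<open>By coherence the union restricts to \<open>Z\<close> on each member's domain
  \<open>U\<close>. Locality then passes the fixed-point equation from the members to the
  union.\<close>

lemma partial_answer_set_Union:
  assumes part: "\<And>U Z. (U, Z) \<in> C \<Longrightarrow> partial_answer_set P U Z"
    and chain: "\<And>U Z U' Z'. (U, Z) \<in> C \<Longrightarrow> (U', Z') \<in> C \<Longrightarrow>
      U \<subseteq> U' \<and> Z' \<inter> U = Z \<or> U' \<subseteq> U \<and> Z \<inter> U' = Z'"
  shows "partial_answer_set P (\<Union>(fst ` C)) (\<Union>(snd ` C))"
    and "\<And>U Z. (U, Z) \<in> C \<Longrightarrow> \<Union>(snd ` C) \<inter> U = Z"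
proof -
  show restr: "\<Union>(snd ` C) \<inter> U = Z" if "(U, Z) \<in> C" for U Z
  proof -
    have "Z \<subseteq> U" using part[OF that] by (auto simp: partial_answer_set_def)
    moreover have "Z' \<inter> U \<subseteq> Z" if "(U', Z') \<in> C" for U' Z'
      using chain[OF \<open>(U, Z) \<in> C\<close> that] part[OF that] by (auto simp: partial_answer_set_def)
    ultimately show ?thesis using that by force
  qed
  let ?V = "\<Union>(fst ` C)" and ?Y = "\<Union>(snd ` C)"
  have dep: "depends_within P ?V ?V"
    using part by (intro depends_within_Union) (auto simp: partial_answer_set_def)
  have "reduct_model P ?Y \<inter> U = Z" if "(U, Z) \<in> C" for U Z
  proof -
    have "depends_within P U U" "reduct_model P Z \<inter> U = Z"
      using part[OF that] by (auto simp: partial_answer_set_def)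
    moreover from this have "Z \<inter> U = Z" by blast
    ultimately show ?thesis using reduct_model_cong_on[of P U U ?Y Z] restr[OF that] by simp
  qed
  then have "reduct_model P ?Y \<inter> ?V = ?Y" by force
  with dep show "partial_answer_set P ?V ?Y" by (simp add: partial_answer_set_def)
qed

theorem order_consistent_answer_set_extension:
  assumes P: "order_consistent P" and Z: "partial_answer_set P U Z"
  obtains X where "answer_set P X" "X \<inter> U = Z"
proof -
  define \<A> where "\<A> = {(V, Y). partial_answer_set P V Y \<and> U \<subseteq> V \<and> Y \<inter> U = Z}"
  define le :: "'a set \<times> 'a set \<Rightarrow> 'a set \<times> 'a set \<Rightarrow> bool"
    where "le p q \<longleftrightarrow> fst p \<subseteq> fst q \<and> snd q \<inter> fst p = snd p" for p q
  have sub: "Y \<subseteq> V" if "(V, Y) \<in> \<A>" for V Y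
    using that by (auto simp: \<A>_def partial_answer_set_def)
  have UZ: "(U, Z) \<in> \<A>" using Z by (auto simp: \<A>_def partial_answer_set_def)
  have "\<exists>m\<in>\<A>. \<forall>p\<in>\<A>. le m p \<longrightarrow> p = m"
  proof (rule predicate_Zorn)
    show "partial_order_on \<A> (relation_of le \<A>)"
    proof (rule partial_order_on_relation_ofI)
      fix p assume "p \<in> \<A>"
      then show "le p p" using sub[of "fst p" "snd p"] by (auto simp: le_def)
    next
      fix p q s assume "le p q" "le q s"
      then show "le p s" unfolding le_def by blast
    next
      \<comment> \<open>\<open>le\<close> compares second components only inside a domain, so
        antisymmetry relies on each being contained in its domain.\<close>
      fix p q assume "p \<in> \<A>" "q \<in> \<A>" and *: "le p q" "le q p"
      then have "snd p \<subseteq> fst p" "snd q \<subseteq> fst q"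
        using sub[of "fst p" "snd p"] sub[of "fst q" "snd q"] by simp_all
      with * show "p = q" unfolding le_def by (intro prod_eqI) blast+
    qed
  next
    fix C assume C: "C \<in> Chains (relation_of le \<A>)"
    then have CA: "C \<subseteq> \<A>" and lin: "\<And>p q. p \<in> C \<Longrightarrow> q \<in> C \<Longrightarrow> le p q \<or> le q p"
      by (auto simp: Chains_def relation_of_def)
    show "\<exists>u\<in>\<A>. \<forall>p\<in>C. le p u"
    proof (cases "C = {}")
      case True
      then show ?thesis using UZ by auto
    next
      case False
      let ?u = "(\<Union>(fst ` C), \<Union>(snd ` C))"
      have part: "partial_answer_set P V Y" if "(V, Y) \<in> C" for V Y
        using that CA by (auto simp: \<A>_def)
      have chain: "V \<subseteq> V' \<and> Y' \<inter> V = Y \<or> V' \<subseteq> V \<and> Y \<inter> V' = Y'"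
        if "(V, Y) \<in> C" "(V', Y') \<in> C" for V Y V' Y'
        using lin[OF that] by (simp add: le_def)
      note union = partial_answer_set_Union[of C P, OF part chain]
      have upper: "le p ?u" if "p \<in> C" for p
        using that union(2)[of "fst p" "snd p"] by (auto simp: le_def)
      obtain V Y where VY: "(V, Y) \<in> C" using False by auto
      then have "U \<subseteq> V" "Y \<inter> U = Z" using CA by (auto simp: \<A>_def)
      then have "U \<subseteq> fst ?u" "snd ?u \<inter> U = Z"
        using upper[OF VY] by (auto simp: le_def)
      then have "?u \<in> \<A>" using union(1) by (simp add: \<A>_def)
      then show ?thesis using upper by blast
    qed
  qed
  then obtain V Y where VY: "(V, Y) \<in> \<A>" and max: "\<And>p. p \<in> \<A> \<Longrightarrow> le (V, Y) p \<Longrightarrow> p = (V, Y)"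
    by auto
  have part: "partial_answer_set P V Y" and "U \<subseteq> V" and YU: "Y \<inter> U = Z"
    using VY by (auto simp: \<A>_def)
  have "V = UNIV"
  proof (rule ccontr)
    assume "V \<noteq> UNIV"
    then obtain V' Y' where *: "partial_answer_set P V' Y'" "V \<subset> V'" "Y' \<inter> V = Y"
      using order_consistent_extension[OF P part] by blast
    then have "(V', Y') \<in> \<A>" using \<open>U \<subseteq> V\<close> YU by (auto simp: \<A>_def)
    then show False using max[of "(V', Y')"] * by (auto simp: le_def)
  qed
  then have "answer_set P Y"
    using part by (simp add: answer_set_iff_reduct_model partial_answer_set_def)
  then show thesis using YU that by blast
qed

section \<open>Adding a fact\<close>

text \<open>The condition on \<open>a\<close> joins two cases: outside \<open>W\<close> the fact
  cannot feed a derivation within \<open>W\<close>, and if \<open>a\<close> is already derivable it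
  adds nothing.\<close>

lemma reduct_model_add_fact_on:
  assumes "depends_within P W Q" and "a \<notin> W - reduct_model P X"
  shows "reduct_model (P \<union> {fact_rule a}) X \<inter> W \<subseteq> reduct_model P X"
proof -
  have "x \<in> W \<longrightarrow> x \<in> reduct_model P X" if "x \<in> reduct_model (P \<union> {fact_rule a}) X" for x
    using that
  proof induction
    case (step r)
    show ?case
    proof
      assume W: "head r \<in> W"
      show "head r \<in> reduct_model P X"
      proof (cases "r \<in> P")
        case True
        with assms(1) W have "fset (pos r) \<subseteq> W" by (auto simp: depends_within_def)
        with True step show ?thesis by (intro reduct_model.step) blast+
      next
        case False
        then show ?thesis using step.hyps(1) assms(2) W by (auto simp: fact_rule_def)
      qed
    qed
  qed
  then show ?thesis by blast
qed

theorem theorem1: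
  fixes P :: "'a program" and a :: 'a and X :: "'a set"
  assumes "order_consistent P"
    and "\<And>Y. answer_set P Y \<Longrightarrow> a \<in> Y"
    and "answer_set (P \<union> {fact_rule a}) X"
  shows "answer_set P X"
proof -
  let ?\<Gamma> = "reduct_model P"
  define W where "W = pos_dep P a"
  define Q where "Q = neg_dep P a"
  have W: "depends_within P W Q" and Q: "depends_within P Q W"
    unfolding W_def Q_def by (rule depends_within_dep)+
  have X: "reduct_model (P \<union> {fact_rule a}) X = X"
    using assms(3) by (simp add: answer_set_iff_reduct_model)
  have sub: "?\<Gamma> X \<subseteq> X" using reduct_model_mono[of P "P \<union> {fact_rule a}" X] X by blast
  have "a \<in> ?\<Gamma> X"
  proof (rule ccontr)
    assume a: "a \<notin> ?\<Gamma> X"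
    have aW: "a \<in> W" by (simp add: W_def pos_dep_neg_dep.self)
    \<comment> \<open>Otherwise the level of \<open>a\<close> would be below itself.\<close>
    have "a \<notin> W \<inter> Q"
      using assms(1) ordLess_irreflexive unfolding order_consistent_def W_def Q_def by blast
    with aW have "a \<notin> Q" by blast
    \<comment> \<open>The fact has no influence on \<open>Q\<close>, so there \<open>X\<close>
      already solves the equation for \<open>P\<close>, in particular on
      \<open>W \<inter> Q\<close>.\<close>
    then have XQ: "?\<Gamma> X \<inter> Q = X \<inter> Q"
      using reduct_model_add_fact_on[OF Q, of a X] X sub by blast
    define Z where "Z = X \<inter> (W \<inter> Q)"
    have WQ: "depends_within P (W \<inter> Q) (W \<inter> Q)"
      using depends_within_Int[OF W Q] by (simp add: Int_commute)
    have "?\<Gamma> Z \<inter> (W \<inter> Q) = ?\<Gamma> X \<inter> (W \<inter> Q)"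
      by (rule reduct_model_cong_on[OF WQ]) (auto simp: Z_def)
    then have "partial_answer_set P (W \<inter> Q) Z"
      using WQ XQ unfolding partial_answer_set_def Z_def by blast
    then obtain Z' where Z': "partial_answer_set P (W \<union> Q) Z'"
      and min: "\<And>Y. Z \<subseteq> Y \<Longrightarrow> ?\<Gamma> (?\<Gamma> Y \<inter> Q) \<inter> W \<subseteq> Y \<Longrightarrow> Z' \<inter> W \<subseteq> Y"
      using minimal_extension[OF W Q] by metis
    have "Z' \<inter> W \<subseteq> ?\<Gamma> X"
    proof (rule min)
      show "Z \<subseteq> ?\<Gamma> X" using XQ by (auto simp: Z_def)
      \<comment> \<open>On \<open>Q\<close> the left side equals \<open>X\<close>, so one more use
        of antitonicity shows that \<open>?\<Gamma> X\<close> is a prefixed point.\<close>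
      have "?\<Gamma> X \<subseteq> ?\<Gamma> (?\<Gamma> X)" using sub by (rule reduct_model_antimono)
      then have "X \<inter> Q \<subseteq> ?\<Gamma> (?\<Gamma> X) \<inter> Q" using XQ by blast
      then show "?\<Gamma> (?\<Gamma> (?\<Gamma> X) \<inter> Q) \<inter> W \<subseteq> ?\<Gamma> X"
        using reduct_model_antimono_on[OF W] by blast
    qed
    moreover obtain Y where "answer_set P Y" "Y \<inter> (W \<union> Q) = Z'"
      using order_consistent_answer_set_extension[OF assms(1) Z'] .
    \<comment> \<open>\<open>Y\<close> agrees with \<open>Z'\<close> on \<open>W\<close>, so
      \<open>a \<in> Y\<close> would put \<open>a\<close> into \<open>?\<Gamma> X\<close>.\<close>
    ultimately show False using assms(2) a aW by blast
  qed
  moreover have "depends_within P UNIV UNIV" by (simp add: depends_within_def)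
  ultimately have "X \<subseteq> ?\<Gamma> X" using reduct_model_add_fact_on[of P UNIV UNIV a X] X by simp
  with sub show ?thesis by (auto simp: answer_set_iff_reduct_model)
qed

end
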